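(* There is a constant $C>0$ such that for every positive integer $k\ge 2$, every obstruction for the class of $k$-letter graphs has at most $2^{C k^2\log k}$ vertices. (That is, any obstruction for $k$-lettericity has at most $2^{O(k^2\log k)}$ vertices.)
   Context: All graphs are finite, simple and undirected. A decoder is a directed graph $D=(\Sigma,A)$ (loops allowed) on a finite alphabet $\Sigma$. An $n$-vertex graph $G=(V,E)$ is a letter graph over $D$ if there exist a map $\ell:V\to\Sigma$ (letter assignment) and a bijection $c:V\to[n]$ (ordering) such that two distinct vertices $x,y$ are adjacent iff either $(\ell(x),\ell(y))\in A$ and $c(x)<c(y)$, or $(\ell(y),\ell(x))\in A$ and $c(y)<c(x)$; $(\ell,c)$ is then a letter realisation of $G$ over $D$, and a $k$-letter realisation if $|\Sigma|=k$. $G$ is a $k$-letter graph if it admits a $k$-letter realisation (over some decoder), and the lettericity of $G$ is the least such $k$. The class of $k$-letter graphs is hereditary (closed under taking induced subgraphs). An obstruction for a hereditary class $\mathcal{C}$ is a graph $H\notin\mathcal{C}$ such that $H\setminus\{v\}\in\mathcal{C}$ for every vertex $v$ of $H$. *)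

theory Defs
  imports Complex_Main "Graph_Theory.Pair_Digraph"
begin

text \<open>
  Finite simple undirected graphs are the \<^locale>\<open>pair_graph\<close>s of Graph\_Theory: finite,
  loopless and symmetric, so that an edge is a pair of opposite arcs. A decoder is a
  \<^locale>\<open>pair_fin_digraph\<close>: a finite digraph without parallel arcs in which loops are allowed.
\<close>

definition letter_realisation ::
  "'l pair_pre_digraph \<Rightarrow> 'a pair_pre_digraph \<Rightarrow> ('a \<Rightarrow> 'l) \<Rightarrow> ('a \<Rightarrow> nat) \<Rightarrow> bool" where
  "letter_realisation D G l c \<longleftrightarrow>
     l ` pverts G \<subseteq> pverts D \<and>
     bij_betw c (pverts G) {1..card (pverts G)} \<and>
     (\<forall>x\<in>pverts G. \<forall>y\<in>pverts G. x \<noteq> y \<longrightarrow>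
        ((x, y) \<in> parcs G \<longleftrightarrow>
           (l x, l y) \<in> parcs D \<and> c x < c y \<or>
           (l y, l x) \<in> parcs D \<and> c y < c x))"

definition letter_graph_over :: "'l pair_pre_digraph \<Rightarrow> 'a pair_pre_digraph \<Rightarrow> bool" where
  "letter_graph_over D G \<longleftrightarrow> (\<exists>l c. letter_realisation D G l c)"

text \<open>
  HOL cannot quantify over the type of letters inside a formula. Letters are natural numbers here,
  which loses no generality: alphabets are finite, and letters can be renamed injectively.
\<close>

definition k_letter_graph :: "nat \<Rightarrow> 'a pair_pre_digraph \<Rightarrow> bool" where
  "k_letter_graph k G \<longleftrightarrow>
     pair_graph G \<and>
     (\<exists>D :: nat pair_pre_digraph.
        pair_fin_digraph D \<and> card (pverts D) = k \<and> letter_graph_over D G)"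

definition delete_vertex :: "'a pair_pre_digraph \<Rightarrow> 'a \<Rightarrow> 'a pair_pre_digraph" where
  "delete_vertex G v =
     \<lparr>pverts = pverts G - {v}, parcs = {e \<in> parcs G. fst e \<noteq> v \<and> snd e \<noteq> v}\<rparr>"

lemma with_proj_delete_vertex:
  "with_proj (delete_vertex G v) = pre_digraph.del_vert (with_proj G) v"
  by (simp add: delete_vertex_def with_proj_def pre_digraph.del_vert_def)

text \<open>A class of graphs is represented by its membership predicate.\<close>

definition obstruction :: "('a pair_pre_digraph \<Rightarrow> bool) \<Rightarrow> 'a pair_pre_digraph \<Rightarrow> bool" where
  "obstruction \<C> H \<longleftrightarrow>
     pair_graph H \<and> \<not> \<C> H \<and> (\<forall>v\<in>pverts H. \<C> (delete_vertex H v))"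

end

theory Submission
  imports Defs
begin

text \<open>
  For a fixed letter assignment, an ordering realising the graph exists iff the relation
  ``\<open>x\<close> has to precede \<open>y\<close>'' is acyclic, and a shortest cycle has at most three vertices per
  letter. Hence realisability of a lettered graph is decided by its subgraphs on \<open>3k\<close> vertices.

  Deleting a vertex from an obstruction and splitting each letter according to adjacency to that
  vertex turns the obstruction into a word over \<open>2k + 1\<close> letters. A word of length
  \<open>m ^ (2k + 1)\<close> contains \<open>m\<close> consecutive blocks with the same set \<open>S\<close> of letters. Delete a
  vertex \<open>v\<close> of the first block and take a \<open>k\<close>-letter realisation of the rest. It induces a map
  from \<open>S\<close> to the \<open>k\<close> new letters in every other block, and for \<open>m = 3k \<cdot> k ^ (2k + 1) + 2\<close> more
  than \<open>3k\<close> blocks induce the same map \<open>t\<close>. Relettering all blocks, including \<open>v\<close>, by \<open>t\<close> gives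
  a realisation of the whole graph: a short cycle can be moved into the blocks of type \<open>t\<close>
  without changing adjacencies or letters.
\<close>

section \<open>Forced precedences and short cycles\<close>

text \<open>
  \<open>(x, y)\<close> is forced iff placing \<open>y\<close> before \<open>x\<close> gives the wrong adjacency. If both orders are
  wrong, then the pair forms a \<open>2\<close>-cycle, so acyclicity covers this case as well.
\<close>

definition forced :: "'l pair_pre_digraph \<Rightarrow> 'a pair_pre_digraph \<Rightarrow> ('a \<Rightarrow> 'l) \<Rightarrow> 'a rel" where
  "forced D G l = {(x, y). x \<in> pverts G \<and> y \<in> pverts G \<and> x \<noteq> y \<and>
     ((x, y) \<in> parcs G \<longleftrightarrow> (l y, l x) \<notin> parcs D)}"

text \<open>An injective ordering places each pair one way round, and since arcs are symmetric that
  way is wrong exactly when it inverts a forced pair. Hence, for a fixed \<open>l\<close> into the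
  alphabet, the realising orderings are the linear extensions of
  \<open>forced D G l\<close>.\<close>

lemma letter_realisation_iff_forced:
  assumes "sym (parcs G)"
  shows "letter_realisation D G l c \<longleftrightarrow>
    l ` pverts G \<subseteq> pverts D \<and> bij_betw c (pverts G) {1..card (pverts G)} \<and>
    (\<forall>(x, y)\<in>forced D G l. c x < c y)"
proof -
  have sym: "(x, y) \<in> parcs G \<longleftrightarrow> (y, x) \<in> parcs G" for x y
    using assms by (meson symE)
  have "(\<forall>x\<in>pverts G. \<forall>y\<in>pverts G. x \<noteq> y \<longrightarrow>
        ((x, y) \<in> parcs G \<longleftrightarrow>
           (l x, l y) \<in> parcs D \<and> c x < c y \<or> (l y, l x) \<in> parcs D \<and> c y < c x))
      \<longleftrightarrow> (\<forall>(x, y)\<in>forced D G l. c x < c y)" (is "?L \<longleftrightarrow> ?R")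
    if "bij_betw c (pverts G) {1..card (pverts G)}"
  proof -
    have total: "c x < c y \<or> c y < c x" if "x \<in> pverts G" "y \<in> pverts G" "x \<noteq> y" for x y
      using that \<open>bij_betw c _ _\<close> by (meson bij_betw_def inj_on_def linorder_neqE_nat)
    show ?thesis
    proof
      assume L: ?L
      show ?R
        using L total by (fastforce simp: forced_def)
    next
      assume R: ?R
      show ?L
      proof (intro ballI impI)
        fix x y assume xy: "x \<in> pverts G" "y \<in> pverts G" "x \<noteq> y"
        have "(x, y) \<in> forced D G l \<longrightarrow> c x < c y" "(y, x) \<in> forced D G l \<longrightarrow> c y < c x"
          using R by auto
        then show "(x, y) \<in> parcs G \<longleftrightarrow>
           (l x, l y) \<in> parcs D \<and> c x < c y \<or> (l y, l x) \<in> parcs D \<and> c y < c x"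
          using xy total[OF xy] sym[of x y] by (auto simp: forced_def)
      qed
    qed
  qed
  then show ?thesis
    unfolding letter_realisation_def by blast
qed

lemma topological_numbering:
  assumes "finite V" "acyclic R"
  shows "\<exists>c. bij_betw c V {1..card V} \<and> (\<forall>x\<in>V. \<forall>y\<in>V. (x, y) \<in> R \<longrightarrow> c x < c y)"
  using assms(1)
proof (induction "card V" arbitrary: V)
  case 0
  then show ?case by (auto simp: bij_betw_def)
next
  case (Suc n)
  let ?R = "R \<inter> V \<times> V"
  have "finite ?R"
    using Suc.prems by blast
  moreover have "acyclic ?R"
    using assms(2) by (rule acyclic_subset) blast
  ultimately have "wf (?R\<inverse>)"
    by (rule finite_acyclic_wf_converse)
  moreover obtain v where "v \<in> V"
    using Suc.hyps(2) by fastforce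
  \<comment> \<open>\<open>z\<close> is a sink of \<open>R\<close> within \<open>V\<close>, so it
    can take the last number.\<close>
  ultimately obtain z where z: "z \<in> V" "\<And>y. (z, y) \<in> ?R \<Longrightarrow> y \<notin> V"
    by (metis converse_iff wfE_min)
  have card: "n = card (V - {z})"
    using Suc.hyps(2) z(1) Suc.prems by simp
  obtain c where c: "bij_betw c (V - {z}) {1..n}"
    "\<forall>x\<in>V - {z}. \<forall>y\<in>V - {z}. (x, y) \<in> R \<longrightarrow> c x < c y"
    using Suc.hyps(1)[OF card] Suc.prems card by auto
  let ?c = "c(z := Suc n)"
  have "bij_betw ?c (V - {z}) {1..n}"
    using c(1) by (rule bij_betw_cong[THEN iffD1, rotated]) simp
  then have "bij_betw ?c ((V - {z}) \<union> {z}) ({1..n} \<union> {Suc n})"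
    by (rule bij_betw_combine) auto
  moreover have "(V - {z}) \<union> {z} = V"
    using z(1) by blast
  moreover have "{1..n} \<union> {Suc n} = {1..card V}"
    unfolding Suc.hyps(2)[symmetric] by auto
  moreover have less: "c x < Suc n" if "x \<in> V" "x \<noteq> z" for x
    using bij_betwE[OF c(1)] that by (simp add: le_imp_less_Suc)
  moreover have "?c x < ?c y" if "x \<in> V" "y \<in> V" "(x, y) \<in> R" for x y
  proof -
    have "x \<noteq> z"
      using z(2)[of y] that by blast
    then show ?thesis
      using less[of x] c(2) that by (cases "y = z") auto
  qed
  ultimately show ?case
    by (intro exI[of _ ?c]) simp
qed

text \<open>
  If \<open>x\<close> and \<open>y\<close> carry the same letter and lie on a cycle without forced \<open>2\<close>-cycles, then \<open>y\<close> is
  comparable with the successor of \<open>x\<close>, so one of two chords shortens the cycle unless \<open>y\<close> is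
  the second successor of \<open>x\<close>.
\<close>

lemma short_forced_cycle:
  assumes fin: "finite (pverts G)" and sym: "sym (parcs G)"
    and "\<not> acyclic (forced D G l)"
  obtains n f where "0 < n" "n \<le> 3 * card (l ` pverts G)" "f n = f 0"
    "\<And>i. i < n \<Longrightarrow> (f i, f (Suc i)) \<in> forced D G l"
proof -
  let ?R = "forced D G l"
  let ?P = "\<lambda>n. 0 < n \<and> (\<exists>x. (x, x) \<in> ?R ^^ n)"
  have "\<exists>n. ?P n"
    using assms(3) by (auto simp: acyclic_def trancl_power)
  then obtain n where n: "?P n" and least: "\<And>m. m < n \<Longrightarrow> \<not> ?P m"
    unfolding exists_least_iff[of ?P] by blast
  then obtain x where "(x, x) \<in> ?R ^^ n"
    by blast
  then obtain f where f: "f 0 = x" "f n = x" "\<And>i. i < n \<Longrightarrow> (f i, f (Suc i)) \<in> ?R"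
    by (auto simp: relpow_fun_conv)
  have seg: "(f i, f j) \<in> ?R ^^ (j - i)" if "i \<le> j" "j \<le> n" for i j
    unfolding relpow_fun_conv using that f(3)
    by (intro exI[of _ "\<lambda>t. f (i + t)"]) auto
  have close: "j \<le> i + 2" if ij: "i < j" "j < n" and l: "l (f i) = l (f j)" for i j
  proof (rule ccontr)
    assume far: "\<not> j \<le> i + 2"
    have "0 < (2::nat) \<and> 2 < n"
      using far ij by simp
    then have "\<not> ?P 2"
      using least by blast
    then have no2: "(f (Suc i), f i) \<notin> ?R"
      using f(3)[of i] ij by (auto simp: numeral_2_eq_2 relcomp_unfold)
    have R: "(f i, f (Suc i)) \<in> ?R"
      using f(3) ij by simp
    have V: "f i \<in> pverts G" "f (Suc i) \<in> pverts G" "f j \<in> pverts G"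
      using R f(3)[of j] ij by (auto simp: forced_def)
    have sym': "(x, y) \<in> parcs G \<longleftrightarrow> (y, x) \<in> parcs G" for x y
      using sym by (meson symE)
    \<comment> \<open>Exactly one order of the two letters is a decoder arc. As \<open>f j\<close>
      shares its letter with \<open>f i\<close>, exactly one order of \<open>f j\<close> and
      \<open>f (Suc i)\<close> is forced.\<close>
    have orient: "(l (f (Suc i)), l (f i)) \<in> parcs D \<longleftrightarrow> (l (f i), l (f (Suc i))) \<notin> parcs D"
      using R no2 V sym' by (auto simp: forced_def)
    then have "f j \<noteq> f (Suc i)"
      using l by auto
    then consider "(f j, f (Suc i)) \<in> ?R" | "(f (Suc i), f j) \<in> ?R"
      using orient V l sym'[of "f j" "f (Suc i)"] by (auto simp: forced_def)
    then show False
    proof cases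
      case 1
      have "(f (Suc i), f (Suc i)) \<in> ?R ^^ Suc (j - Suc i)"
        using seg[of "Suc i" j] 1 ij by auto
      then show False
        using least[of "Suc (j - Suc i)"] far ij by auto
    next
      case 2
      \<comment> \<open>The chord skips the stretch from \<open>Suc i\<close> to \<open>j\<close>
        and leaves a cycle of length \<open>n - (j - i) + 2\<close>, which is below \<open>n\<close>
        only if \<open>j\<close> is more than two places after \<open>i\<close>.\<close>
      have "(f j, f 0) \<in> ?R ^^ (n - j)" "(f 0, f (Suc i)) \<in> ?R ^^ Suc i"
        using seg[of j n] seg[of 0 "Suc i"] ij f(1,2) by auto
      then have "(f j, f (Suc i)) \<in> ?R ^^ (n - j + Suc i)"
        unfolding relpow_add by blast
      then have "(f j, f j) \<in> ?R ^^ Suc (n - j + Suc i)"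
        using 2 by auto
      then show False
        using least[of "Suc (n - j + Suc i)"] far ij by auto
    qed
  qed
  \<comment> \<open>Positions with equal letters are at most two apart, so the residue mod 3
    separates them.\<close>
  let ?h = "\<lambda>i. (l (f i), i mod 3)"
  have "i = j" if "i < n" "j < n" "?h i = ?h j" for i j
  proof -
    have *: "i' = j'" if "i' \<le> j'" "j' \<le> i' + 2" "i' mod 3 = j' mod 3" for i' j' :: nat
      using that by presburger
    show ?thesis
      using close[of i j] close[of j i] that *[of i j] *[of j i]
      by (cases i j rule: linorder_cases) auto
  qed
  then have "inj_on ?h {..<n}"
    by (auto intro!: inj_onI)
  moreover have "?h ` {..<n} \<subseteq> l ` pverts G \<times> {..<3}"
    using f(3) by (auto simp: forced_def)
  ultimately have "card {..<n} \<le> card (l ` pverts G \<times> {..<3::nat})"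
    using fin by (intro card_inj_on_le) auto
  then have "n \<le> 3 * card (l ` pverts G)"
    by (simp add: card_cartesian_product)
  with n f show thesis
    by (intro that[of n f]) auto
qed

text \<open>A forced cycle of \<open>G\<close> could be chosen with at most \<open>3 * k\<close>
  vertices. Its image under \<open>\<phi>\<close> has the same letters and adjacencies, so it would
  be forced in \<open>G'\<close>, and \<open>c'\<close> would increase all the way round. Hence
  there is no cycle, and a topological numbering realises \<open>G\<close>.\<close>

lemma k_letter_graph_if_locally_embeds:
  fixes D :: "nat pair_pre_digraph"
  assumes G: "pair_graph G" and G': "pair_graph G'"
    and D: "pair_fin_digraph D" "card (pverts D) = k"
    and real: "letter_realisation D G' l' c'"
    and l: "l ` pverts G \<subseteq> pverts D"
    and embed: "\<And>X. X \<subseteq> pverts G \<Longrightarrow> card X \<le> 3 * k \<Longrightarrow>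
      \<exists>\<phi>. inj_on \<phi> X \<and> \<phi> ` X \<subseteq> pverts G' \<and> (\<forall>x\<in>X. l' (\<phi> x) = l x) \<and>
        (\<forall>x\<in>X. \<forall>y\<in>X. x \<noteq> y \<longrightarrow> ((\<phi> x, \<phi> y) \<in> parcs G' \<longleftrightarrow> (x, y) \<in> parcs G))"
  shows "k_letter_graph k G"
proof -
  interpret G: pair_graph G by fact
  interpret G': pair_graph G' by fact
  interpret D: pair_fin_digraph D by fact
  have symG: "sym (parcs G)" and symG': "sym (parcs G')"
    using G.arcs_symmetric G'.arcs_symmetric by (auto intro: symI)
  have "acyclic (forced D G l)"
  proof (rule ccontr)
    assume "\<not> acyclic (forced D G l)"
    then obtain n f where n: "0 < n" "n \<le> 3 * card (l ` pverts G)" and "f n = f 0"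
      and f: "\<And>i. i < n \<Longrightarrow> (f i, f (Suc i)) \<in> forced D G l"
      using short_forced_cycle[OF G.pair_finite_verts symG] by metis
    have "card (l ` pverts G) \<le> k"
      using card_mono[OF D.pair_finite_verts l] D(2) by simp
    moreover have "card (f ` {..<n}) \<le> n"
      using card_image_le[of "{..<n}" f] by simp
    ultimately have "card (f ` {..<n}) \<le> 3 * k"
      using n(2) by linarith
    moreover have "f ` {..<n} \<subseteq> pverts G"
      using f by (auto simp: forced_def)
    ultimately obtain \<phi> where \<phi>: "inj_on \<phi> (f ` {..<n})" "\<phi> ` f ` {..<n} \<subseteq> pverts G'"
      "\<forall>x\<in>f ` {..<n}. l' (\<phi> x) = l x"
      "\<forall>x\<in>f ` {..<n}. \<forall>y\<in>f ` {..<n}. x \<noteq> y \<longrightarrow>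
        ((\<phi> x, \<phi> y) \<in> parcs G' \<longleftrightarrow> (x, y) \<in> parcs G)"
      using embed by meson
    have mem: "f i \<in> f ` {..<n}" if "i \<le> n" for i
      using that n(1) \<open>f n = f 0\<close> by (cases "i = n") auto
    have "c' (\<phi> (f i)) < c' (\<phi> (f (Suc i)))" if "i < n" for i
    proof -
      have "f i \<in> f ` {..<n}" "f (Suc i) \<in> f ` {..<n}"
        using mem that by auto
      then have "(\<phi> (f i), \<phi> (f (Suc i))) \<in> forced D G' l'"
        using f[OF that] \<phi> unfolding forced_def
        by (auto simp: inj_on_eq_iff simp del: image_iff)
      then show ?thesis
        using real unfolding letter_realisation_iff_forced[OF symG'] by blast
    qed
    then have "i \<le> n \<Longrightarrow> c' (\<phi> (f 0)) + i \<le> c' (\<phi> (f i))" for i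
      by (induction i) (auto simp: Suc_le_eq intro: le_less_trans)
    from this[of n] show False
      using n(1) \<open>f n = f 0\<close> by simp
  qed
  from topological_numbering[OF G.pair_finite_verts this]
  obtain c where "letter_realisation D G l c"
    unfolding letter_realisation_iff_forced[OF symG] using l by (auto simp: forced_def)
  then show ?thesis
    unfolding k_letter_graph_def letter_graph_over_def using G D by blast
qed

section \<open>Repetition in words and pigeonhole arguments\<close>

text \<open>Induction on the alphabet: cut the window into \<open>m\<close> pieces, each
  \<open>m\<close> times shorter. Either every piece uses all of \<open>L\<close>, or some piece
  omits a letter and is a window over a smaller alphabet.\<close>

lemma blocks_with_equal_content:
  fixes g :: "nat \<Rightarrow> 'l"
  assumes "finite L" "card L = n" "0 < m" "g ` {a..<a + m ^ n} \<subseteq> L"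
  shows "\<exists>b q S. a \<le> b \<and> 0 < q \<and> b + m * q \<le> a + m ^ n \<and>
    (\<forall>i<m. g ` {b + i * q..<b + Suc i * q} = S)"
  using assms
proof (induction n arbitrary: a L)
  \<comment> \<open>The window has length 1, so its letter contradicts the empty alphabet.\<close>
  case 0
  then show ?case by auto
next
  case (Suc n)
  show ?case
  proof (cases "\<forall>i<m. g ` {a + i * m ^ n..<a + Suc i * m ^ n} = L")
    case True
    then show ?thesis
      using Suc.prems by (intro exI[of _ a] exI[of _ "m ^ n"] exI[of _ L]) auto
  next
    case False
    then obtain i where i: "i < m" "g ` {a + i * m ^ n..<a + Suc i * m ^ n} \<noteq> L"
      by blast
    have "Suc i * m ^ n \<le> m * m ^ n"
      using i(1) by (intro mult_right_mono) auto
    then have le: "a + i * m ^ n + m ^ n \<le> a + m ^ Suc n"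
      by simp
    have sub: "g ` {a + i * m ^ n..<a + Suc i * m ^ n} \<subseteq> L"
      using Suc.prems(4) le by (intro order_trans[OF image_mono Suc.prems(4)]) auto
    then obtain s where s: "s \<in> L" "s \<notin> g ` {a + i * m ^ n..<a + Suc i * m ^ n}"
      using i(2) by blast
    have "g ` {a + i * m ^ n..<a + i * m ^ n + m ^ n} \<subseteq> L - {s}"
      using sub s(2) by (auto simp: algebra_simps)
    from Suc.IH[OF _ _ Suc.prems(3) this]
    obtain b q S where "a + i * m ^ n \<le> b" "0 < q" "b + m * q \<le> a + i * m ^ n + m ^ n"
      "\<forall>i<m. g ` {b + i * q..<b + Suc i * q} = S"
      using Suc.prems s(1) by auto
    then show ?thesis
      using le by (intro exI[of _ b] exI[of _ q] exI[of _ S]) auto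
  qed
qed

text \<open>Each element of \<open>Y\<close> goes to the element of \<open>I\<close> of the same
  rank. This later spreads occupied positions over distinct blocks in their order.\<close>

lemma strict_mono_on_into_finite:
  fixes Y :: "nat set" and I :: "nat set"
  assumes "finite Y" "finite I" "card Y \<le> card I"
  obtains h where "h ` Y \<subseteq> I" "strict_mono_on Y h"
proof -
  let ?r = "\<lambda>y. card {z \<in> Y. z < y}"
  let ?h = "\<lambda>y. sorted_list_of_set I ! ?r y"
  have less: "?r y < length (sorted_list_of_set I)" if "y \<in> Y" for y
  proof -
    have "?r y < card Y"
      using that assms(1) by (intro psubset_card_mono) auto
    then show ?thesis
      using assms by simp
  qed
  have "?r x < ?r y" if "x \<in> Y" "y \<in> Y" "x < y" for x y
    using that assms(1) by (intro psubset_card_mono) auto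
  then have "strict_mono_on Y ?h"
    using less strict_sorted_list_of_set[of I]
    by (auto intro!: strict_mono_onI simp: sorted_wrt_iff_nth_less)
  moreover have "?h ` Y \<subseteq> I"
    using nth_mem[OF less] assms(2) by auto
  ultimately show thesis
    using that by blast
qed

lemma large_fibre:
  assumes "finite I" "finite T" "g ` I \<subseteq> T" "card T * N < card I"
  obtains t where "t \<in> T" "N < card {i \<in> I. g i = t}"
proof -
  have "\<exists>t\<in>T. N < card {i \<in> I. g i = t}"
  proof (rule ccontr)
    assume "\<not> ?thesis"
    then have le: "card {i \<in> I. g i = t} \<le> N" if "t \<in> T" for t
      using that by force
    have "card I = card (\<Union>t\<in>T. {i \<in> I. g i = t})"
      using assms(3) by (intro arg_cong[where f = card]) auto
    also have "\<dots> \<le> (\<Sum>t\<in>T. card {i \<in> I. g i = t})"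
      using assms(2) by (rule card_UN_le)
    also have "\<dots> \<le> card T * N"
      using le by (rule sum_bounded_above[where K = N, simplified])
    finally show False
      using assms(4) by simp
  qed
  then show thesis
    using that by blast
qed

section \<open>Relettering a long word\<close>

text \<open>In effect \<open>hom\<close> says that \<open>lam\<close> and \<open>p\<close> present
  \<open>G\<close> as a letter graph over some decoder on \<open>L\<close>. A map preserving
  \<open>lam\<close> and the order by \<open>p\<close> therefore preserves adjacency, which is what
  makes the local embeddings work.\<close>

lemma k_letter_graph_if_long_word:
  fixes G :: "'a pair_pre_digraph" and p :: "'a \<Rightarrow> nat" and lam :: "'a \<Rightarrow> 's"
  assumes G: "pair_graph G" and p: "bij_betw p (pverts G) {..<N}"
    and L: "finite L" "card L = n" "lam ` pverts G \<subseteq> L"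
    and hom: "\<And>x y x' y'. \<lbrakk>x \<in> pverts G; y \<in> pverts G; x' \<in> pverts G; y' \<in> pverts G;
      p x < p y; p x' < p y'; lam x = lam x'; lam y = lam y'\<rbrakk> \<Longrightarrow>
      (x, y) \<in> parcs G \<longleftrightarrow> (x', y') \<in> parcs G"
    and del: "\<And>v. v \<in> pverts G \<Longrightarrow> k_letter_graph k (delete_vertex G v)"
    and k: "0 < k" and long: "(3 * k * k ^ n + 2) ^ n \<le> N"
  shows "k_letter_graph k G"
proof -
  interpret G: pair_graph G by fact
  let ?V = "pverts G"
  \<comment> \<open>A block induces one of at most \<open>k ^ n\<close> maps to the new letters.
    Block 0 is set aside for the deleted vertex; the other \<open>m - 1\<close> blocks exceed
    \<open>3 * k\<close> times that number by one.\<close>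
  define m where "m = 3 * k * k ^ n + 2"
  define e where "e = the_inv_into ?V p"
  have e: "e j \<in> ?V" "p (e j) = j" if "j < N" for j
    using that p unfolding e_def bij_betw_def
    by (auto intro: the_inv_into_into f_the_inv_into_f)
  have ep: "e (p x) = x" if "x \<in> ?V" for x
    using that p unfolding e_def bij_betw_def by (auto intro: the_inv_into_f_f)
  have "(\<lambda>j. lam (e j)) ` {0..<0 + m ^ n} \<subseteq> L"
    using e(1) long L(3) unfolding m_def by fastforce
  from blocks_with_equal_content[OF L(1,2) _ this]
  obtain b q S where bq: "0 < q" "b + m * q \<le> m ^ n"
    and S: "\<And>i. i < m \<Longrightarrow> (\<lambda>j. lam (e j)) ` {b + i * q..<b + Suc i * q} = S"
    unfolding m_def by auto
  have m: "0 < m" "1 < m"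
    by (auto simp: m_def)
  have bN: "b + m * q \<le> N"
    using bq(2) long m_def by simp
  have block_le: "b + Suc i * q \<le> b + m * q" if "i < m" for i
    using that by (intro add_left_mono mult_right_mono) auto
  have "\<exists>x\<in>?V. p x \<in> {b + i * q..<b + Suc i * q} \<and> lam x = s" if i: "i < m" "s \<in> S" for i s
  proof -
    obtain j where j: "j \<in> {b + i * q..<b + Suc i * q}" "lam (e j) = s"
      using S[OF i(1)] i(2) by blast
    moreover have "j < N"
      using j(1) block_le[OF i(1)] bN by auto
    ultimately show ?thesis
      using e by (intro bexI[of _ "e j"]) auto
  qed
  then obtain rep where rep: "\<And>i s. i < m \<Longrightarrow> s \<in> S \<Longrightarrow> rep i s \<in> ?V \<and>
      p (rep i s) \<in> {b + i * q..<b + Suc i * q} \<and> lam (rep i s) = s"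
    by metis
  have mid_S: "lam x \<in> S" if "x \<in> ?V" "p x \<in> {b..<b + m * q}" for x
  proof -
    let ?i = "(p x - b) div q"
    have "p x - b < m * q"
      using that(2) by auto
    then have "?i < m"
      by (rule less_mult_imp_div_less)
    moreover have "p x \<in> {b + ?i * q..<b + Suc ?i * q}"
      using that(2) dividend_less_div_times[OF bq(1), of "p x - b"]
        div_times_less_eq_dividend[of "p x - b" q] by (auto simp del: div_times_less_eq_dividend)
    ultimately have "lam (e (p x)) \<in> S"
      using S[of ?i] by blast
    then show ?thesis
      using ep[OF that(1)] by simp
  qed
  have "S \<subseteq> L"
    using rep[OF m(1)] L(3) by force
  have finS: "finite S"
    using \<open>S \<subseteq> L\<close> L(1) by (rule finite_subset)
  have "card S \<le> n"
    using \<open>S \<subseteq> L\<close> L card_mono by blast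

  \<comment> \<open>\<open>v\<close> opens block 0, so representatives from later blocks survive its
    deletion.\<close>
  define v where "v = e b"
  have "b < N"
    using bN mult_pos_pos[OF m(1) bq(1)] by linarith
  then have v: "v \<in> ?V" "p v = b"
    using e by (auto simp: v_def)
  let ?G' = "delete_vertex G v"
  have V': "pverts ?G' = ?V - {v}"
    by (simp add: delete_vertex_def)
  have arcs': "(x, y) \<in> parcs ?G' \<longleftrightarrow> (x, y) \<in> parcs G" if "x \<noteq> v" "y \<noteq> v" for x y
    using that by (simp add: delete_vertex_def)
  obtain D :: "nat pair_pre_digraph" and l' c' where G': "pair_graph ?G'"
    and D: "pair_fin_digraph D" "card (pverts D) = k" and real: "letter_realisation D ?G' l' c'"
    using del[OF v(1)] unfolding k_letter_graph_def letter_graph_over_def by blast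
  have finD: "finite (pverts D)"
    using D(1) by (rule pair_fin_digraph.pair_finite_verts)
  have l': "l' x \<in> pverts D" if "x \<in> ?V" "x \<noteq> v" for x
    using real that unfolding letter_realisation_def V' by blast
  have rep_v: "rep i s \<noteq> v" if "1 \<le> i" "i < m" "s \<in> S" for i s
  proof -
    have "0 < i * q"
      using that(1) bq(1) by simp
    moreover have "b + i * q \<le> p (rep i s)"
      using rep[OF that(2,3)] by simp
    ultimately have "b < p (rep i s)"
      by linarith
    then show ?thesis
      using v(2) by auto
  qed

  \<comment> \<open>Restriction to \<open>S\<close> makes the types extensional, so they lie in a
    finite set that can be counted.\<close>
  let ?type = "\<lambda>i. restrict (\<lambda>s. l' (rep i s)) S"
  let ?T = "S \<rightarrow>\<^sub>E pverts D"
  have "k ^ card S \<le> k ^ n"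
    using k \<open>card S \<le> n\<close> by (intro power_increasing) auto
  then have "card ?T \<le> k ^ n"
    using finS D(2) by (simp add: card_PiE)
  then have "card ?T * (3 * k) \<le> k ^ n * (3 * k)"
    by (rule mult_right_mono) simp
  also have "\<dots> < card {1..<m}"
    by (simp add: m_def)
  finally have "card ?T * (3 * k) < card {1..<m}" .
  moreover have "?type ` {1..<m} \<subseteq> ?T"
    using rep rep_v l' by (auto simp: PiE_iff)
  moreover have "finite ?T"
    using finS finD by (intro finite_PiE) auto
  ultimately obtain t where t: "t \<in> ?T" "3 * k < card {i \<in> {1..<m}. ?type i = t}"
    using large_fibre[of "{1..<m}" ?T ?type "3 * k"] by blast
  define J where "J = {i \<in> {1..<m}. ?type i = t}"
  have J: "1 \<le> i" "i < m" "\<And>s. s \<in> S \<Longrightarrow> l' (rep i s) = t s" if "i \<in> J" for i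
    using that restrict_apply'[of _ S "\<lambda>s. l' (rep i s)"] by (auto simp: J_def)

  define mid where "mid x \<longleftrightarrow> p x \<in> {b..<b + m * q}" for x
  \<comment> \<open>Only the run of blocks is relettered. This includes \<open>v\<close>, on which
    the realisation of \<open>?G'\<close> does not constrain \<open>l'\<close>.\<close>
  define l where "l x = (if mid x then t (lam x) else l' x)" for x
  have "mid v"
    using v(2) m(1) bq(1) by (simp add: mid_def)
  show ?thesis
  proof (rule k_letter_graph_if_locally_embeds[OF G G' D real])
    show "l ` ?V \<subseteq> pverts D"
      using mid_S t(1) l' \<open>mid v\<close> by (auto simp: l_def mid_def PiE_iff)
  next
    fix X assume X: "X \<subseteq> ?V" "card X \<le> 3 * k"
    have finX: "finite X"
      using X(1) G.pair_finite_verts by (rule finite_subset)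
    let ?Y = "p ` {x \<in> X. mid x}"
    have "card ?Y \<le> card {x \<in> X. mid x}"
      using finX by (intro card_image_le) simp
    also have "\<dots> \<le> card X"
      using finX by (intro card_mono) auto
    finally have "card ?Y \<le> card J"
      using X(2) t(2) by (simp add: J_def)
    then obtain h where h: "h ` ?Y \<subseteq> J" "strict_mono_on ?Y h"
      using strict_mono_on_into_finite[of ?Y J] finX by (auto simp: J_def)
    \<comment> \<open>A vertex of the run moves to the representative of its letter in a block of
      type \<open>t\<close>, where \<open>l'\<close> agrees with the new letter \<open>l x\<close>.
      All other vertices stay.\<close>
    define \<phi> where "\<phi> x = (if mid x then rep (h (p x)) (lam x) else x)" for x
    have hJ: "h (p x) \<in> J" if "x \<in> X" "mid x" for x
      using h(1) that by blast
    have XS: "lam x \<in> S" if "x \<in> X" "mid x" for x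
      using mid_S X(1) that by (auto simp: mid_def)
    have mid_\<phi>: "p (\<phi> x) \<in> {b + h (p x) * q..<b + Suc (h (p x)) * q}" "p (\<phi> x) \<in> {b..<b + m * q}"
      if "x \<in> X" "mid x" for x
    proof -
      show "p (\<phi> x) \<in> {b + h (p x) * q..<b + Suc (h (p x)) * q}"
        using rep[OF J(2)[OF hJ] XS] that by (simp add: \<phi>_def)
      then show "p (\<phi> x) \<in> {b..<b + m * q}"
        using block_le[OF J(2)[OF hJ[OF that]]] by auto
    qed
    have \<phi>: "\<phi> x \<in> ?V" "\<phi> x \<noteq> v" "lam (\<phi> x) = lam x" "l' (\<phi> x) = l x" if "x \<in> X" for x
    proof -
      have "\<phi> x \<in> ?V \<and> \<phi> x \<noteq> v \<and> lam (\<phi> x) = lam x \<and> l' (\<phi> x) = l x"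
      proof (cases "mid x")
        case True
        note i = hJ[OF that True] and s = XS[OF that True]
        show ?thesis
          using rep[OF J(2)[OF i] s] rep_v[OF J(1)[OF i] J(2)[OF i] s] J(3)[OF i s] True
          by (simp add: \<phi>_def l_def)
      next
        case False
        then show ?thesis
          using that X(1) \<open>mid v\<close> by (auto simp: \<phi>_def l_def)
      qed
      then show "\<phi> x \<in> ?V" "\<phi> x \<noteq> v" "lam (\<phi> x) = lam x" "l' (\<phi> x) = l x"
        by auto
    qed
    \<comment> \<open>Within the run, order is kept because \<open>h\<close> is strictly increasing.
      Across its border, it is kept because the run is an interval of positions that
      \<open>\<phi>\<close> maps into itself.\<close>
    have mono: "p (\<phi> x) < p (\<phi> y)" if xy: "x \<in> X" "y \<in> X" "p x < p y" for x y
    proof -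
      consider "mid x" "mid y" | "mid x" "\<not> mid y" | "\<not> mid x" "mid y" | "\<not> mid x" "\<not> mid y"
        by blast
      then show ?thesis
      proof cases
        case 1
        have "h (p x) < h (p y)"
          using h(2) xy 1 by (auto simp: strict_mono_on_def)
        then have "Suc (h (p x)) * q \<le> h (p y) * q"
          by (intro mult_right_mono) auto
        then show ?thesis
          using mid_\<phi>(1)[OF xy(1) 1(1)] mid_\<phi>(1)[OF xy(2) 1(2)] by simp
      next
        case 2
        then show ?thesis
          using mid_\<phi>(2)[OF xy(1)] xy(3) by (auto simp: mid_def \<phi>_def)
      next
        case 3
        then show ?thesis
          using mid_\<phi>(2)[OF xy(2)] xy(3) by (auto simp: mid_def \<phi>_def)
      next
        case 4
        then show ?thesis
          using xy(3) by (simp add: \<phi>_def)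
      qed
    qed
    have total: "p x < p y \<or> p y < p x" if "x \<in> X" "y \<in> X" "x \<noteq> y" for x y
      using p X(1) that by (metis bij_betw_def inj_on_eq_iff linorder_neqE_nat subsetD)
    have sym: "(x, y) \<in> parcs G \<longleftrightarrow> (y, x) \<in> parcs G" for x y
      using G.arcs_symmetric by blast
    have adj: "(\<phi> x, \<phi> y) \<in> parcs G \<longleftrightarrow> (x, y) \<in> parcs G" if "x \<in> X" "y \<in> X" "x \<noteq> y" for x y
    proof -
      have *: "(\<phi> x, \<phi> y) \<in> parcs G \<longleftrightarrow> (x, y) \<in> parcs G" if "x \<in> X" "y \<in> X" "p x < p y" for x y
        using that \<phi> X(1) mono by (intro hom) auto
      show ?thesis
        using total[OF that] *[of x y] *[of y x] sym that by metis
    qed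
    have "inj_on \<phi> X"
      using total mono by (metis inj_onI less_irrefl)
    moreover have "\<phi> ` X \<subseteq> pverts ?G'"
      using \<phi> V' by blast
    moreover have "(\<phi> x, \<phi> y) \<in> parcs ?G' \<longleftrightarrow> (x, y) \<in> parcs G"
      if "x \<in> X" "y \<in> X" "x \<noteq> y" for x y
      using adj[OF that] arcs' \<phi>(2) that by simp
    ultimately show "\<exists>\<phi>. inj_on \<phi> X \<and> \<phi> ` X \<subseteq> pverts ?G' \<and> (\<forall>x\<in>X. l' (\<phi> x) = l x) \<and>
        (\<forall>x\<in>X. \<forall>y\<in>X. x \<noteq> y \<longrightarrow> ((\<phi> x, \<phi> y) \<in> parcs ?G' \<longleftrightarrow> (x, y) \<in> parcs G))"
      using \<phi>(4) by blast
  qed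
qed

section \<open>The bound for obstructions\<close>

lemma card_obstruction_less:
  assumes "obstruction (k_letter_graph k) H" "0 < k"
  shows "card (pverts H) < (3 * k * k ^ (2 * k + 1) + 2) ^ (2 * k + 1)"
proof (rule ccontr)
  assume long: "\<not> ?thesis"
  have H: "pair_graph H" "\<not> k_letter_graph k H"
    and del: "\<And>v. v \<in> pverts H \<Longrightarrow> k_letter_graph k (delete_vertex H v)"
    using assms(1) by (auto simp: obstruction_def)
  interpret H: pair_graph H by fact
  have "0 < (3 * k * k ^ (2 * k + 1) + 2) ^ (2 * k + 1)"
    by simp
  then have "0 < card (pverts H)"
    using long by linarith
  then obtain v where v: "v \<in> pverts H"
    by fastforce
  let ?V' = "pverts (delete_vertex H v)"
  have V': "?V' = pverts H - {v}"
    by (simp add: delete_vertex_def)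
  obtain D :: "nat pair_pre_digraph" and l c where D: "pair_fin_digraph D" "card (pverts D) = k"
    and real: "letter_realisation D (delete_vertex H v) l c"
    using del[OF v] unfolding k_letter_graph_def letter_graph_over_def by blast
  define N where "N = card (pverts H)"
  have N: "N = Suc (card ?V')"
    using v \<open>0 < card (pverts H)\<close> by (simp add: V' N_def card_Diff_singleton)
  have c: "bij_betw c ?V' {1..card ?V'}"
    using real by (simp add: letter_realisation_def)
  have l: "l x \<in> pverts D" if "x \<in> pverts H" "x \<noteq> v" for x
    using real that by (auto simp: letter_realisation_def V')
  have adj: "(x, y) \<in> parcs H \<longleftrightarrow> (l x, l y) \<in> parcs D"
    if "x \<in> pverts H" "y \<in> pverts H" "x \<noteq> v" "y \<noteq> v" "c x < c y" for x y
  proof -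
    have "x \<in> ?V'" "y \<in> ?V'" "x \<noteq> y" "\<not> c y < c x"
      using that by (auto simp: V')
    then have "(x, y) \<in> parcs (delete_vertex H v) \<longleftrightarrow> (l x, l y) \<in> parcs D"
      using real that(5) unfolding letter_realisation_def by blast
    then show ?thesis
      using that by (simp add: delete_vertex_def)
  qed
  \<comment> \<open>The values of \<open>c\<close> start at 1, so 0 puts \<open>v\<close> in front
    of all other vertices.\<close>
  define p where "p = c(v := 0)"
  define lam where "lam x = (if x = v then None else Some (l x, (v, x) \<in> parcs H))" for x
  define L where "L = insert None (Some ` (pverts D \<times> (UNIV :: bool set)))"
  have finD: "finite (pverts D)"
    using D(1) by (rule pair_fin_digraph.pair_finite_verts)
  have "bij_betw p ?V' {1..card ?V'}"
    using c by (rule bij_betw_cong[THEN iffD1, rotated]) (simp add: p_def V')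
  then have "bij_betw p (?V' \<union> {v}) ({1..card ?V'} \<union> {0})"
    by (rule bij_betw_combine) (auto simp: p_def)
  moreover have "?V' \<union> {v} = pverts H"
    using v V' by auto
  moreover have "{1..card ?V'} \<union> {0} = {..<N}"
    unfolding N by (auto simp del: card_Diff_singleton)
  ultimately have p: "bij_betw p (pverts H) {..<N}"
    by simp
  have L: "finite L" "card L = 2 * k + 1"
    using finD D(2) by (auto simp: L_def card_image card_cartesian_product)
  have lam: "lam ` pverts H \<subseteq> L"
    using l by (auto simp: lam_def L_def)
  have hom: "(x, y) \<in> parcs H \<longleftrightarrow> (x', y') \<in> parcs H"
    if "x \<in> pverts H" "y \<in> pverts H" "x' \<in> pverts H" "y' \<in> pverts H"
      "p x < p y" "p x' < p y'" "lam x = lam x'" "lam y = lam y'" for x y x' y'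
  proof -
    \<comment> \<open>Being first, \<open>v\<close> is never the later vertex of a pair. As the
      earlier one it is recognised by \<open>None\<close>, and the Boolean in the letter of
      \<open>y\<close> settles adjacency.\<close>
    have "y \<noteq> v" "y' \<noteq> v"
      using that(5,6) by (auto simp: p_def)
    then show ?thesis
      using that adj[of x y] adj[of x' y'] by (auto simp: lam_def p_def split: if_splits)
  qed
  have "k_letter_graph k H"
    using long by (intro k_letter_graph_if_long_word[OF H(1) p L lam hom del assms(2)])
      (auto simp: N_def)
  then show False
    using H(2) by contradiction
qed

theorem theorem4p7:
  shows "\<exists>C::real. C > 0 \<and>
    (\<forall>k::nat. k \<ge> 2 \<longrightarrow>
      (\<forall>H :: 'a pair_pre_digraph. obstruction (k_letter_graph k) H \<longrightarrow>
        real (card (pverts H)) \<le> 2 powr (C * (real k)\<^sup>2 * log 2 (real k))))"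
proof (intro exI[of _ "12::real"] conjI allI impI)
  fix k :: nat and H :: "'a pair_pre_digraph"
  assume k: "2 \<le> k" and H: "obstruction (k_letter_graph k) H"
  \<comment> \<open>For \<open>k \<ge> 2\<close> the base is at most \<open>k ^ (2 * k + 4)\<close>,
    hence at most \<open>k ^ (4 * k)\<close>, and the outer exponent is at most
    \<open>3 * k\<close>. The product of these exponents gives the constant 12.\<close>
  have "3 * k * k ^ (2 * k + 1) + 2 \<le> 4 * (k * k ^ (2 * k + 1))"
    using k mult_le_mono[of 2 k 1 "k ^ (2 * k + 1)"] by simp
  also have "\<dots> \<le> (k * k) * (k * k ^ (2 * k + 1))"
    using k mult_le_mono[of 2 k 2 k] by (intro mult_right_mono) auto
  also have "\<dots> = k ^ (2 * k + 4)"
    by (simp add: power_add power4_eq_xxxx)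
  also have "\<dots> \<le> k ^ (4 * k)"
    using k by (intro power_increasing) auto
  finally have "(3 * k * k ^ (2 * k + 1) + 2) ^ (2 * k + 1) \<le> (k ^ (4 * k)) ^ (2 * k + 1)"
    by (rule power_mono) simp
  also have "\<dots> \<le> (k ^ (4 * k)) ^ (3 * k)"
    using k by (intro power_increasing) auto
  also have "\<dots> = k ^ (12 * k\<^sup>2)"
    by (simp add: power2_eq_square flip: power_mult)
  finally have "card (pverts H) \<le> k ^ (12 * k\<^sup>2)"
    using card_obstruction_less[OF H] k by simp
  then have "real (card (pverts H)) \<le> real k ^ (12 * k\<^sup>2)"
    by (metis of_nat_le_iff of_nat_power)
  also have "\<dots> = real k powr (12 * (real k)\<^sup>2)"
    using k powr_realpow[of "real k" "12 * k\<^sup>2"] by simp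
  also have "\<dots> = 2 powr (log 2 (real k) * (12 * (real k)\<^sup>2))"
    using k powr_powr[of 2 "log 2 (real k)" "12 * (real k)\<^sup>2"] by simp
  finally show "real (card (pverts H)) \<le> 2 powr (12 * (real k)\<^sup>2 * log 2 (real k))"
    by (simp add: mult.commute)
qed simp

end
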